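(* Let $\phi:(-b_0,b_0)\to\mathbb R$ be a positive smooth function. Let $\alpha$ be a Euclidean norm, and $\beta$ a linear functional on a real vector space $V$ such that $\alpha^*(\beta)\in[0,b_0)$. Consider the function $F:=\alpha\,\phi\big(\tfrac{\beta}{\alpha}\big)$, and the groups $$\mathrm{Iso}(F):=\{\sigma\in\mathrm{Diff}(V):\sigma^*F=F\},\qquad \mathrm{Iso}_\beta(\alpha):=\{\sigma\in\mathrm{Iso}(\alpha):\sigma^*\beta=\beta\}.$$ Then $\mathrm{Iso}_\beta(\alpha)\subset\mathrm{Iso}(F)$. If, additionally, the derivative $\phi'$ is nowhere vanishing, then $\mathrm{Iso}(F)=\mathrm{Iso}_\beta(\alpha)$.
   Context: $V$ is a finite-dimensional real vector space. A Euclidean norm is $\alpha(\cdot)=\sqrt{\mathsf a(\cdot,\cdot)}$ for an inner product $\mathsf a$ on $V$, and $\alpha^*$ denotes the dual norm on $V^*$. The functions $\alpha$, $\beta$ and $F$ on $V$ (with $F(0)=0$) are regarded as translation-invariant functions on $TV$ through the identification $T_pV\cong V$ for every $p\in V$. $\mathrm{Diff}(V)$ is the group of diffeomorphisms of $V$, and for $\sigma\in\mathrm{Diff}(V)$ and a function $G$ on $TV$ the pullback is $(\sigma^*G)(v)=G(d\sigma_p(v))$ for $v\in T_pV$. $\mathrm{Iso}(\alpha)=\{\sigma\in\mathrm{Diff}(V):\sigma^*\alpha=\alpha\}$. *)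

theory Defs
  imports "HOL-Analysis.Analysis"
begin

text \<open>
  The finite-dimensional real vector space \<open>V\<close> is the universe of a type of class
  \<^class>\<open>real_normed_vector\<close> spanned by a finite set. (Unlike \<^class>\<open>euclidean_space\<close>, this
  admits dimension 0.) The norm of the type class serves only to provide the canonical topology and
  smooth structure of \<open>V\<close>, which do not depend on it since all norms on \<open>V\<close> are equivalent. The
  Euclidean norm \<open>\<alpha>\<close> is independent of it.
\<close>

text \<open>
  All iterated directional derivatives along constant vectors exist and are continuous; in finite
  dimension and on an open set this is the usual notion of class \<open>C\<^sup>n\<close>. The Frechet derivatives are
  the unrestricted ones (\<open>at x\<close>), so these notions are meant for open \<open>S\<close>.
\<close>

primrec C_on :: "nat \<Rightarrow> 'a::real_normed_vector set \<Rightarrow> ('a \<Rightarrow> 'b::real_normed_vector) \<Rightarrow> bool" where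
  "C_on 0 S f \<longleftrightarrow> continuous_on S f"
| "C_on (Suc n) S f \<longleftrightarrow> (\<forall>x\<in>S. f differentiable at x) \<and>
     (\<forall>v. C_on n S (\<lambda>x. frechet_derivative f (at x) v))"

definition smooth_on :: "'a::real_normed_vector set \<Rightarrow> ('a \<Rightarrow> 'b::real_normed_vector) \<Rightarrow> bool" where
  "smooth_on S f \<longleftrightarrow> (\<forall>n. C_on n S f)"

definition Diff :: "('a::real_normed_vector \<Rightarrow> 'a) set" where
  "Diff = {\<sigma>. bij \<sigma> \<and> smooth_on UNIV \<sigma> \<and> smooth_on UNIV (inv \<sigma>)}"

definition inner_product :: "('a::real_vector \<Rightarrow> 'a \<Rightarrow> real) \<Rightarrow> bool" where
  "inner_product a \<longleftrightarrow> bilinear a \<and> (\<forall>v w. a v w = a w v) \<and> (\<forall>v. v \<noteq> 0 \<longrightarrow> 0 < a v v)"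

definition euclidean_norm :: "('a::real_vector \<Rightarrow> real) \<Rightarrow> bool" where
  "euclidean_norm \<alpha> \<longleftrightarrow> (\<exists>a. inner_product a \<and> \<alpha> = (\<lambda>v. sqrt (a v v)))"

text \<open>For a linear functional on a finite-dimensional space the supremum is that of a bounded,
  nonempty set (also in dimension 0, where a supremum over unit vectors would not be).\<close>

definition dual_norm :: "('a::real_vector \<Rightarrow> real) \<Rightarrow> ('a \<Rightarrow> real) \<Rightarrow> real" where
  "dual_norm \<alpha> \<beta> = (SUP v\<in>{v. \<alpha> v \<le> 1}. \<bar>\<beta> v\<bar>)"

text \<open>The tangent bundle \<open>TV\<close> is \<open>V \<times> V\<close>; the pair \<open>(p, v)\<close> is the vector \<open>v\<close> in the tangent
  space at \<open>p\<close>.\<close>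

definition on_TV :: "('a \<Rightarrow> real) \<Rightarrow> 'a \<times> 'a \<Rightarrow> real" where
  "on_TV g = (\<lambda>(p, v). g v)"

definition pullback :: "('a::real_normed_vector \<Rightarrow> 'a) \<Rightarrow> ('a \<times> 'a \<Rightarrow> real) \<Rightarrow> 'a \<times> 'a \<Rightarrow> real" where
  "pullback \<sigma> G = (\<lambda>(p, v). G (\<sigma> p, frechet_derivative \<sigma> (at p) v))"

definition Iso :: "('a::real_normed_vector \<Rightarrow> real) \<Rightarrow> ('a \<Rightarrow> 'a) set" where
  "Iso F = {\<sigma> \<in> Diff. pullback \<sigma> (on_TV F) = on_TV F}"

definition Iso_preserving :: "('a::real_normed_vector \<Rightarrow> real) \<Rightarrow> ('a \<Rightarrow> real) \<Rightarrow> ('a \<Rightarrow> 'a) set" where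
  "Iso_preserving \<beta> \<alpha> = {\<sigma> \<in> Iso \<alpha>. pullback \<sigma> (on_TV \<beta>) = on_TV \<beta>}"

text \<open>The convention \<open>F 0 = 0\<close> holds because \<open>\<alpha> 0 = 0\<close>, whatever the value of the quotient.\<close>

definition alpha_beta :: "('a \<Rightarrow> real) \<Rightarrow> ('a \<Rightarrow> real) \<Rightarrow> (real \<Rightarrow> real) \<Rightarrow> 'a \<Rightarrow> real" where
  "alpha_beta \<alpha> \<beta> \<phi> = (\<lambda>v. \<alpha> v * \<phi> (\<beta> v / \<alpha> v))"

end

theory Submission
  imports Defs
begin

text \<open>
  The functions \<open>\<alpha>\<close>, \<open>\<beta>\<close> and \<open>F\<close> are translation-invariant, so membership in each group is a condition
  on the differentials \<open>L = d\<sigma>\<^sub>p\<close> alone, one point \<open>p\<close> at a time. As \<open>F v\<close> depends only on \<open>\<alpha> v\<close>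
  and \<open>\<beta> v\<close>, preserving both of them preserves \<open>F\<close>.

  Conversely, \<open>\<alpha>\<close> and \<open>\<beta>\<close> can be recovered from the pair \<open>F v\<close>, \<open>F (- v)\<close>. With \<open>s = \<beta> v / \<alpha> v\<close>, for
  \<open>v \<noteq> 0\<close>, these numbers are \<open>\<alpha> v * \<phi> s\<close> and \<open>\<alpha> v * \<phi> (- s)\<close>, and their quotient is
  \<open>\<phi> s / \<phi> (- s)\<close>. If \<open>\<phi>'\<close> has no zero, then \<open>\<phi>\<close> is strictly monotone, hence so is this quotient as a
  function of \<open>s\<close>, and the quotient determines \<open>s\<close> (\<open>reflection_ratio_injective\<close>). Then
  \<open>\<alpha> v = F v / \<phi> s\<close> and \<open>\<beta> v = s * \<alpha> v\<close> are determined too (\<open>alpha_beta_determines\<close>). A differential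
  is odd, so it preserves \<open>F (- v)\<close> whenever it preserves \<open>F\<close>; therefore it preserves \<open>\<alpha>\<close> and \<open>\<beta>\<close>.

  This recovery needs \<open>s\<close> to lie in the domain of \<open>\<phi>\<close>, which follows from \<open>\<bar>\<beta> v\<bar> \<le> \<alpha>\<^sup>*(\<beta>) * \<alpha> v\<close>. The supremum that
  defines \<open>\<alpha>\<^sup>*(\<beta>)\<close> gives this only once it is known to be taken over a bounded set. Boundedness
  is where the finite dimension enters: \<open>\<beta>\<close> is represented by a vector (\<open>riesz_on_span\<close>), and
  the Cauchy-Schwarz inequality applies.
\<close>

section \<open>Linear functionals and the dual norm of a Euclidean norm\<close>

lemma inner_product_Cauchy_Schwarz:
  assumes "inner_product a"
  shows "\<bar>a v w\<bar> \<le> sqrt (a v v) * sqrt (a w w)"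
proof (cases "w = 0")
  case True
  then show ?thesis
    using assms by (simp add: inner_product_def bilinear_lzero bilinear_rzero)
next
  case False
  have bil: "bilinear a" and sym: "a w v = a v w" and pos: "0 < a w w"
    using assms False by (auto simp: inner_product_def)
  have nonneg: "0 \<le> a x x" for x
    using assms by (cases "x = 0") (auto simp: inner_product_def bilinear_lzero less_imp_le)
  define c where "c = a v w / a w w"
  \<comment> \<open>The component of \<open>v\<close> orthogonal to \<open>w\<close> has nonnegative square.\<close>
  have "0 \<le> a (v - c *\<^sub>R w) (v - c *\<^sub>R w)"
    by (rule nonneg)
  also have "\<dots> = a v v - (a v w)\<^sup>2 / a w w"
    using pos by (simp add: bilinear_lsub[OF bil] bilinear_rsub[OF bil] bilinear_lmul[OF bil]
        bilinear_rmul[OF bil] sym c_def field_simps power2_eq_square)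
  finally have "(a v w)\<^sup>2 \<le> a v v * a w w"
    using pos by (simp add: field_simps)
  then show ?thesis
    by (metis real_sqrt_abs real_sqrt_le_iff real_sqrt_mult)
qed

text \<open>The induction extends a representing vector by Gram-Schmidt: to add a generator \<open>x\<close>, the
  hypothesis is applied to the functional \<open>a x\<close> itself, which yields the orthogonal projection \<open>u\<close> of
  \<open>x\<close>; the vector for \<open>\<beta>\<close> is then corrected in the direction of \<open>x - u\<close>.\<close>

lemma riesz_on_span:
  assumes a: "inner_product a" and "finite B" and "linear \<beta>"
  shows "\<exists>w\<in>span B. \<forall>v\<in>span B. \<beta> v = a w v"
  using assms(2,3)
proof (induction B arbitrary: \<beta> rule: finite_induct)
  case empty
  then show ?case
    using a by (simp add: inner_product_def bilinear_lzero linear_0)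
next
  case (insert x B)
  have bil: "bilinear a" and sym: "\<And>v w. a v w = a w v"
    using a by (auto simp: inner_product_def)
  obtain w where w: "w \<in> span B" "\<And>v. v \<in> span B \<Longrightarrow> \<beta> v = a w v"
    using insert.IH[OF insert.prems] by blast
  have "linear (a x)"
    using bil by (simp add: bilinear_def)
  then obtain u where u: "u \<in> span B" "\<And>v. v \<in> span B \<Longrightarrow> a x v = a u v"
    using insert.IH by blast
  define y where "y = x - u"
  have orth: "a y v = 0" if "v \<in> span B" for v
    using u(2)[OF that] by (simp add: y_def bilinear_lsub[OF bil])
  have sub: "span B \<subseteq> span (insert x B)"
    by (intro span_mono) auto
  show ?case
  proof (cases "y = 0")
    case True
    then have "span (insert x B) = span B"
      using u(1) by (simp add: y_def span_redundant)
    then show ?thesis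
      using w by auto
  next
    case False
    then have pos: "0 < a y y"
      using a by (simp add: inner_product_def)
    define w' where "w' = w + (\<beta> y / a y y) *\<^sub>R y"
    have "y \<in> span (insert x B)"
      unfolding y_def using u(1) sub by (intro span_diff) (auto intro: span_base)
    then have w'_in: "w' \<in> span (insert x B)"
      unfolding w'_def using w(1) sub by (intro span_add span_scale) auto
    have "\<beta> v = a w' v" if v: "v \<in> span (insert x B)" for v
    proof -
      obtain k where "v - k *\<^sub>R x \<in> span B"
        using v by (auto simp: span_breakdown_eq)
      then have "v - k *\<^sub>R x + k *\<^sub>R u \<in> span B"
        using u(1) by (intro span_add span_scale)
      then have z: "v - k *\<^sub>R y \<in> span B" (is "?z \<in> _")
        by (simp add: y_def algebra_simps)
      have "\<beta> v = \<beta> (?z + k *\<^sub>R y)" "a w' v = a w' (?z + k *\<^sub>R y)"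
        by simp_all
      moreover have "\<beta> (?z + k *\<^sub>R y) = a w ?z + k * \<beta> y"
        unfolding linear_add[OF insert.prems] linear_scale[OF insert.prems] w(2)[OF z] by simp
      moreover have "a w' (?z + k *\<^sub>R y) = a w ?z + k * \<beta> y"
      proof -
        have wy: "a w y = 0"
          using orth[OF w(1)] sym by simp
        show ?thesis
          unfolding w'_def bilinear_radd[OF bil] bilinear_ladd[OF bil] bilinear_rmul[OF bil]
            bilinear_lmul[OF bil] orth[OF z] wy
          using pos by simp
      qed
      ultimately show ?thesis
        by simp
    qed
    then show ?thesis
      using w'_in by blast
  qed
qed

lemma euclidean_norm_zero: "euclidean_norm \<alpha> \<Longrightarrow> \<alpha> 0 = 0"
  by (auto simp: euclidean_norm_def inner_product_def bilinear_lzero)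

lemma euclidean_norm_pos: "euclidean_norm \<alpha> \<Longrightarrow> v \<noteq> 0 \<Longrightarrow> 0 < \<alpha> v"
  by (auto simp: euclidean_norm_def inner_product_def)

lemma euclidean_norm_scale:
  assumes "euclidean_norm \<alpha>"
  shows "\<alpha> (c *\<^sub>R v) = \<bar>c\<bar> * \<alpha> v"
proof -
  obtain a where a: "bilinear a" "\<alpha> = (\<lambda>v. sqrt (a v v))"
    using assms by (auto simp: euclidean_norm_def inner_product_def)
  have "a (c *\<^sub>R v) (c *\<^sub>R v) = c\<^sup>2 * a v v"
    by (simp add: bilinear_lmul[OF a(1)] bilinear_rmul[OF a(1)] power2_eq_square)
  then show ?thesis
    by (simp add: a(2) real_sqrt_mult)
qed

lemma euclidean_norm_minus: "euclidean_norm \<alpha> \<Longrightarrow> \<alpha> (- v) = \<alpha> v"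
  using euclidean_norm_scale[of \<alpha> "- 1" v] by simp

lemma bdd_above_functional_on_unit_ball:
  fixes \<alpha> \<beta> :: "'a::real_vector \<Rightarrow> real"
  assumes fin: "\<exists>B :: 'a set. finite B \<and> span B = UNIV"
    and \<alpha>: "euclidean_norm \<alpha>" and "linear \<beta>"
  shows "bdd_above ((\<lambda>v. \<bar>\<beta> v\<bar>) ` {v. \<alpha> v \<le> 1})"
proof -
  obtain a where a: "inner_product a" and \<alpha>_eq: "\<alpha> = (\<lambda>v. sqrt (a v v))"
    using \<alpha> by (auto simp: euclidean_norm_def)
  obtain w where w: "\<And>v. \<beta> v = a w v"
    using fin riesz_on_span[OF a _ \<open>linear \<beta>\<close>] by (metis UNIV_I)
  have "\<bar>\<beta> v\<bar> \<le> \<alpha> w" if "\<alpha> v \<le> 1" for v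
  proof -
    have "0 \<le> \<alpha> w"
      using euclidean_norm_pos[OF \<alpha>, of w] euclidean_norm_zero[OF \<alpha>] by (cases "w = 0") auto
    then have "\<alpha> w * \<alpha> v \<le> \<alpha> w"
      using that by (simp add: mult_left_le)
    then show ?thesis
      using inner_product_Cauchy_Schwarz[OF a, of w v] by (simp add: w \<alpha>_eq)
  qed
  then show ?thesis
    by (auto intro!: bdd_aboveI2)
qed

lemma abs_functional_quotient_le_dual_norm:
  fixes \<alpha> \<beta> :: "'a::real_vector \<Rightarrow> real"
  assumes "\<exists>B :: 'a set. finite B \<and> span B = UNIV"
    and \<alpha>: "euclidean_norm \<alpha>" and \<beta>: "linear \<beta>" and "v \<noteq> 0"
  shows "\<bar>\<beta> v / \<alpha> v\<bar> \<le> dual_norm \<alpha> \<beta>"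
proof -
  let ?u = "(1 / \<alpha> v) *\<^sub>R v"
  have pos: "0 < \<alpha> v"
    using euclidean_norm_pos[OF \<alpha> \<open>v \<noteq> 0\<close>] .
  then have "\<alpha> ?u \<le> 1"
    by (simp add: euclidean_norm_scale[OF \<alpha>])
  then have "\<bar>\<beta> ?u\<bar> \<le> dual_norm \<alpha> \<beta>"
    unfolding dual_norm_def
    by (intro cSUP_upper bdd_above_functional_on_unit_ball assms) auto
  then show ?thesis
    by (simp add: linear_scale[OF \<beta>])
qed

section \<open>Recovering the two arguments from the values at opposite vectors\<close>

text \<open>Continuity of \<open>\<phi>'\<close> gives it a constant sign.\<close>

lemma strict_monotone_of_deriv_nonzero:
  fixes \<phi> :: "real \<Rightarrow> real"
  assumes sm: "smooth_on {l<..<r} \<phi>"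
    and nz: "\<forall>s\<in>{l<..<r}. deriv \<phi> s \<noteq> 0"
  shows "strict_mono_on {l<..<r} \<phi> \<or> strict_antimono_on {l<..<r} \<phi>"
proof -
  let ?I = "{l<..<r}"
  have "C_on 1 ?I \<phi>"
    using sm by (simp add: smooth_on_def)
  then have diff: "\<And>x. x \<in> ?I \<Longrightarrow> \<phi> differentiable at x"
    and cont: "continuous_on ?I (\<lambda>x. frechet_derivative \<phi> (at x) 1)"
    by auto
  have der: "(\<phi> has_real_derivative deriv \<phi> x) (at x)" if "x \<in> ?I" for x
    using diff[OF that] DERIV_deriv_iff_real_differentiable by blast
  have fd: "frechet_derivative \<phi> (at x) 1 = deriv \<phi> x" if "x \<in> ?I" for x
    using frechet_derivative_at[OF der[OF that, unfolded has_field_derivative_def]] by (metis mult.right_neutral)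
  have "continuous_on ?I (deriv \<phi>)"
    by (rule continuous_on_eq[OF cont fd])
  then have conn: "connected (deriv \<phi> ` ?I)"
    by (intro connected_continuous_image) auto
  have "(\<forall>x\<in>?I. 0 < deriv \<phi> x) \<or> (\<forall>x\<in>?I. deriv \<phi> x < 0)"
  proof (rule ccontr)
    assume "\<not> ?thesis"
    then obtain x y where "x \<in> ?I" "y \<in> ?I" "deriv \<phi> x \<le> 0" "0 \<le> deriv \<phi> y"
      by (meson not_less)
    then have "0 \<in> deriv \<phi> ` ?I"
      using conn[unfolded connected_iff_interval] by blast
    then show False
      using nz by auto
  qed
  then show ?thesis
  proof
    assume pos: "\<forall>x\<in>?I. 0 < deriv \<phi> x"
    have "\<phi> s < \<phi> t" if "s \<in> ?I" "t \<in> ?I" "s < t" for s t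
    proof (rule DERIV_pos_imp_increasing[OF \<open>s < t\<close>])
      fix x assume "s \<le> x" "x \<le> t"
      then have "x \<in> ?I" using that by auto
      then show "\<exists>y. (\<phi> has_real_derivative y) (at x) \<and> 0 < y"
        using der pos by blast
    qed
    then show ?thesis
      by (auto simp: monotone_on_def)
  next
    assume neg: "\<forall>x\<in>?I. deriv \<phi> x < 0"
    have "\<phi> s > \<phi> t" if "s \<in> ?I" "t \<in> ?I" "s < t" for s t
    proof (rule DERIV_neg_imp_decreasing[OF \<open>s < t\<close>])
      fix x assume "s \<le> x" "x \<le> t"
      then have "x \<in> ?I" using that by auto
      then show "\<exists>y. (\<phi> has_real_derivative y) (at x) \<and> y < 0"
        using der neg by blast
    qed
    then show ?thesis
      by (auto simp: monotone_on_def)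
  qed
qed

text \<open>The equation says that \<open>\<phi> s / \<phi> (- s)\<close> takes the same value at \<open>s\<close> and \<open>t\<close>. If \<open>\<phi>\<close> increases,
  then numerator and denominator of this quotient vary in opposite directions, so it increases
  as well.\<close>

lemma reflection_ratio_injective:
  fixes \<phi> :: "real \<Rightarrow> real"
  assumes mono: "strict_mono_on {-b<..<b} \<phi> \<or> strict_antimono_on {-b<..<b} \<phi>"
    and pos: "\<forall>s\<in>{-b<..<b}. 0 < \<phi> s"
    and st: "s \<in> {-b<..<b}" "t \<in> {-b<..<b}"
    and eq: "\<phi> s * \<phi> (- t) = \<phi> t * \<phi> (- s)"
  shows "s = t"
proof -
  have False if xy: "x \<in> {-b<..<b}" "y \<in> {-b<..<b}" "x < y"
    and eq': "\<phi> x * \<phi> (- y) = \<phi> y * \<phi> (- x)" for x y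
  proof -
    have neg: "- x \<in> {-b<..<b}" "- y \<in> {-b<..<b}" "- y < - x"
      using xy by auto
    have p: "0 < \<phi> x" "0 < \<phi> y" "0 < \<phi> (- x)" "0 < \<phi> (- y)"
      using pos xy neg by auto
    from mono show False
    proof
      assume m: "strict_mono_on {-b<..<b} \<phi>"
      have "\<phi> x < \<phi> y" "\<phi> (- y) < \<phi> (- x)"
        using xy neg monotone_onD[OF m] by blast+
      then have "\<phi> x * \<phi> (- y) < \<phi> y * \<phi> (- x)"
        using p by (intro mult_strict_mono) auto
      then show False using eq' by simp
    next
      assume m: "strict_antimono_on {-b<..<b} \<phi>"
      have "\<phi> y < \<phi> x" "\<phi> (- x) < \<phi> (- y)"
        using xy neg monotone_onD[OF m] by blast+
      then have "\<phi> y * \<phi> (- x) < \<phi> x * \<phi> (- y)"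
        using p by (intro mult_strict_mono) auto
      then show False using eq' by simp
    qed
  qed
  from this[of s t] this[of t s] show ?thesis
    using st eq by (cases s t rule: linorder_cases) auto
qed

lemma alpha_beta_determines:
  fixes \<alpha> \<beta> :: "'a::real_vector \<Rightarrow> real"
  assumes \<alpha>: "euclidean_norm \<alpha>" and \<beta>: "linear \<beta>"
    and range: "\<And>v. v \<noteq> 0 \<Longrightarrow> \<beta> v / \<alpha> v \<in> {-b<..<b}"
    and pos: "\<forall>s\<in>{-b<..<b}. 0 < \<phi> s"
    and mono: "strict_mono_on {-b<..<b} \<phi> \<or> strict_antimono_on {-b<..<b} \<phi>"
    and eq: "alpha_beta \<alpha> \<beta> \<phi> w = alpha_beta \<alpha> \<beta> \<phi> v"
    and eq_minus: "alpha_beta \<alpha> \<beta> \<phi> (- w) = alpha_beta \<alpha> \<beta> \<phi> (- v)"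
  shows "\<alpha> w = \<alpha> v \<and> \<beta> w = \<beta> v"
proof -
  have F_pos: "0 < alpha_beta \<alpha> \<beta> \<phi> x" if "x \<noteq> 0" for x
    unfolding alpha_beta_def using euclidean_norm_pos[OF \<alpha> that] pos range[OF that] by simp
  have F_zero: "alpha_beta \<alpha> \<beta> \<phi> 0 = 0"
    by (simp add: alpha_beta_def euclidean_norm_zero[OF \<alpha>])
  show ?thesis
  proof (cases "v = 0")
    case True
    then have "w = 0"
      using F_pos[of w] F_zero eq by fastforce
    then show ?thesis
      using True by simp
  next
    case False
    then have w: "w \<noteq> 0"
      using F_pos[of v] F_zero eq by fastforce
    define s t where "s = \<beta> v / \<alpha> v" and "t = \<beta> w / \<alpha> w"
    have s: "s \<in> {-b<..<b}" and t: "t \<in> {-b<..<b}"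
      using range False w by (auto simp: s_def t_def)
    have \<alpha>_pos: "0 < \<alpha> v" "0 < \<alpha> w"
      using euclidean_norm_pos[OF \<alpha>] False w by auto
    have e1: "\<alpha> w * \<phi> t = \<alpha> v * \<phi> s"
      using eq by (simp add: alpha_beta_def s_def t_def)
    have e2: "\<alpha> w * \<phi> (- t) = \<alpha> v * \<phi> (- s)"
      using eq_minus by (simp add: alpha_beta_def s_def t_def euclidean_norm_minus[OF \<alpha>] linear_neg[OF \<beta>])
    have "(\<alpha> w * \<alpha> v) * (\<phi> s * \<phi> (- t)) = (\<alpha> v * \<phi> s) * (\<alpha> w * \<phi> (- t))"
      by simp
    also have "\<dots> = (\<alpha> w * \<phi> t) * (\<alpha> v * \<phi> (- s))"
      by (simp only: e1 e2)
    also have "\<dots> = (\<alpha> w * \<alpha> v) * (\<phi> t * \<phi> (- s))"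
      by simp
    finally have "\<phi> s * \<phi> (- t) = \<phi> t * \<phi> (- s)"
      using \<alpha>_pos by simp
    then have "s = t"
      using reflection_ratio_injective[OF mono pos s t] by blast
    moreover have "0 < \<phi> s"
      using pos s by blast
    ultimately have "\<alpha> w = \<alpha> v"
      using e1 by simp
    then show ?thesis
      using \<open>s = t\<close> \<alpha>_pos by (simp add: s_def t_def)
  qed
qed

section \<open>Isometries of translation-invariant functions\<close>

lemma pullback_on_TV_eq_iff:
  "pullback \<sigma> (on_TV g) = on_TV g \<longleftrightarrow> (\<forall>p v. g (frechet_derivative \<sigma> (at p) v) = g v)"
  by (auto simp: pullback_def on_TV_def fun_eq_iff)

lemma linear_frechet_derivative_Diff:
  assumes "\<sigma> \<in> Diff"
  shows "linear (frechet_derivative \<sigma> (at p))"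
proof -
  have "C_on 1 UNIV \<sigma>"
    using assms by (simp add: Diff_def smooth_on_def)
  then show ?thesis
    by (simp add: linear_frechet_derivative)
qed

theorem corollary3p4:
  fixes \<phi> :: "real \<Rightarrow> real" and b\<^sub>0 :: real
    and \<alpha> \<beta> F :: "'a::real_normed_vector \<Rightarrow> real"
  assumes "\<exists>B :: 'a set. finite B \<and> span B = UNIV"
    and "smooth_on {-b\<^sub>0<..<b\<^sub>0} \<phi>"
    and "\<forall>s\<in>{-b\<^sub>0<..<b\<^sub>0}. 0 < \<phi> s"
    and "euclidean_norm \<alpha>"
    and "linear \<beta>"
    and "dual_norm \<alpha> \<beta> \<in> {0..<b\<^sub>0}"
    and "F = alpha_beta \<alpha> \<beta> \<phi>"
  shows "Iso_preserving \<beta> \<alpha> \<subseteq> Iso F \<and>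
    ((\<forall>s\<in>{-b\<^sub>0<..<b\<^sub>0}. deriv \<phi> s \<noteq> 0) \<longrightarrow> Iso F = Iso_preserving \<beta> \<alpha>)"
proof (intro conjI impI)
  show sub: "Iso_preserving \<beta> \<alpha> \<subseteq> Iso F"
    by (auto simp: Iso_preserving_def Iso_def pullback_on_TV_eq_iff assms(7) alpha_beta_def)
  assume nz: "\<forall>s\<in>{-b\<^sub>0<..<b\<^sub>0}. deriv \<phi> s \<noteq> 0"
  have range: "\<beta> v / \<alpha> v \<in> {-b\<^sub>0<..<b\<^sub>0}" if "v \<noteq> 0" for v
    using abs_functional_quotient_le_dual_norm[OF assms(1,4,5) that] assms(6)
    unfolding greaterThanLessThan_iff atLeastLessThan_iff by linarith
  have "\<sigma> \<in> Iso_preserving \<beta> \<alpha>" if \<sigma>: "\<sigma> \<in> Iso F" for \<sigma>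
  proof -
    have "\<sigma> \<in> Diff"
      using \<sigma> by (simp add: Iso_def)
    have F_L: "F (frechet_derivative \<sigma> (at p) v) = F v" for p v
      using \<sigma> by (simp add: Iso_def pullback_on_TV_eq_iff)
    have "F (- frechet_derivative \<sigma> (at p) v) = F (- v)" for p v
      using F_L[of p "- v"] by (simp add: linear_neg[OF linear_frechet_derivative_Diff[OF \<open>\<sigma> \<in> Diff\<close>]])
    then have "\<alpha> (frechet_derivative \<sigma> (at p) v) = \<alpha> v \<and> \<beta> (frechet_derivative \<sigma> (at p) v) = \<beta> v"
      for p v
      using F_L
      by (intro alpha_beta_determines[OF assms(4,5) range assms(3)
            strict_monotone_of_deriv_nonzero[OF assms(2) nz]]) (auto simp: assms(7))
    then show ?thesis
      using \<open>\<sigma> \<in> Diff\<close> by (simp add: Iso_preserving_def Iso_def pullback_on_TV_eq_iff)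
  qed
  with sub show "Iso F = Iso_preserving \<beta> \<alpha>"
    by blast
qed

end
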